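(* Let $X$ be a $3$-Hausdorff homogeneous topological space. Then $|X|\le 2^{2^{c(X)\pi\chi(X)}}$.
   Context: No separation axioms are assumed unless stated. The Hausdorff number $H(X)$ of a topological space $X$ is the least cardinal $\kappa$ (finite or infinite) such that for every $A\subseteq X$ with $|A|\ge\kappa$ there are open neighbourhoods $U_a$ of $a$, for $a\in A$, with $\bigcap_{a\in A}U_a=\emptyset$. $X$ is $3$-Hausdorff if $H(X)\le 3$. $X$ is homogeneous if for all $x,y\in X$ there is a homeomorphism $h:X\to X$ with $h(x)=y$. $c(X)$ is the cellularity (supremum of cardinalities of families of pairwise disjoint nonempty open sets) and $\pi\chi(X)$ is the $\pi$-character (supremum over $x\in X$ of the least cardinality of a local $\pi$-base at $x$, i.e. a family of nonempty open sets such that each neighbourhood of $x$ contains a member of it). All cardinal functions are multiplied by $\omega$, hence are infinite. *)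

theory Defs
  imports "HOL-Analysis.Analysis"
begin

unbundle cardinal_syntax

(* Cardinals are the cardinal orders of Main, considered up to =o.  Every cardinal function below
   takes its value in a type of cardinals that is large enough for the minimum or supremum over
   that type to be the minimum or supremum among all cardinals: see card_Sup_least,
   Hausdorff_number_separating and Hausdorff_number_least. *)

definition card_Min :: "'k rel set \<Rightarrow> 'k rel" where
  "card_Min R = (SOME r. r \<in> R \<and> (\<forall>s\<in>R. r \<le>o s))"

definition card_Sup :: "'k rel set \<Rightarrow> 'k rel" where
  "card_Sup R = card_Min {r. Card_order r \<and> (\<forall>s\<in>R. s \<le>o r)}"

(* The intersection is taken inside the space, so that it is the whole space if A is empty. *)
definition points_separated :: "'a topology \<Rightarrow> 'a set \<Rightarrow> bool" where
  "points_separated X A \<longleftrightarrow>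
     (\<exists>U. (\<forall>a\<in>A. openin X (U a) \<and> a \<in> U a) \<and> topspace X \<inter> (\<Inter>a\<in>A. U a) = {})"

(* Values are cardinals on 'a set because the Hausdorff number can be as large as the cardinal
   successor of the cardinality of the space (e.g. for indiscrete spaces). *)
definition Hausdorff_number :: "'a topology \<Rightarrow> 'a set rel" where
  "Hausdorff_number X =
     card_Min {k. Card_order k \<and> (\<forall>A. A \<subseteq> topspace X \<and> k \<le>o |A| \<longrightarrow> points_separated X A)}"

definition three_Hausdorff :: "'a topology \<Rightarrow> bool" where
  "three_Hausdorff X \<longleftrightarrow> Hausdorff_number X \<le>o |{..<3::nat}|"

definition homogeneous_space :: "'a topology \<Rightarrow> bool" where
  "homogeneous_space X \<longleftrightarrow>
     (\<forall>x\<in>topspace X. \<forall>y\<in>topspace X. \<exists>h. homeomorphic_map X X h \<and> h x = y)"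

definition cellular_family :: "'a topology \<Rightarrow> 'a set set \<Rightarrow> bool" where
  "cellular_family X \<U> \<longleftrightarrow> (\<forall>U\<in>\<U>. openin X U \<and> U \<noteq> {}) \<and> pairwise disjnt \<U>"

(* The factor natLeq is the convention that cardinal functions are multiplied by omega; for a
   nonempty space it makes the value infinite. *)
definition cellularity :: "'a topology \<Rightarrow> ('a set \<times> nat) rel" where
  "cellularity X = card_Sup (card_of ` {\<U>. cellular_family X \<U>}) *c natLeq"

definition local_pi_base :: "'a topology \<Rightarrow> 'a \<Rightarrow> 'a set set \<Rightarrow> bool" where
  "local_pi_base X x \<B> \<longleftrightarrow>
     (\<forall>B\<in>\<B>. openin X B \<and> B \<noteq> {}) \<and> (\<forall>U. openin X U \<and> x \<in> U \<longrightarrow> (\<exists>B\<in>\<B>. B \<subseteq> U))"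

definition pi_character_at :: "'a topology \<Rightarrow> 'a \<Rightarrow> 'a set rel" where
  "pi_character_at X x = card_Min (card_of ` {\<B>. local_pi_base X x \<B>})"

definition pi_character :: "'a topology \<Rightarrow> ('a set \<times> nat) rel" where
  "pi_character X = card_Sup (pi_character_at X ` topspace X) *c natLeq"


lemma card_Min:
  assumes "R \<noteq> {}" "\<And>r. r \<in> R \<Longrightarrow> Card_order r"
  shows card_Min_in: "card_Min R \<in> R" and card_Min_le: "\<And>s. s \<in> R \<Longrightarrow> card_Min R \<le>o s"
proof -
  have "\<exists>r. r \<in> R \<and> (\<forall>s\<in>R. r \<le>o s)"
    using exists_minim_Card_order[of R] assms by blast
  from someI_ex[OF this]
  show "card_Min R \<in> R" "\<And>s. s \<in> R \<Longrightarrow> card_Min R \<le>o s"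
    unfolding card_Min_def by blast+
qed

(* A cardinal below one on type 'k has a representative on type 'k. *)
lemma Card_order_representative:
  fixes t :: "'b rel" and u :: "'k rel"
  assumes "Card_order t" "Card_order u" "t \<le>o u"
  obtains t' :: "'k rel" where "Card_order t'" "t' =o t"
proof -
  have "|Field t| \<le>o |Field u|"
    using card_of_mono2[OF assms(3)] .
  then obtain B where B: "|Field t| =o |B|" "B \<subseteq> Field u"
    using internalize_card_of_ordLeq2[of "Field t" "Field u"] by blast
  have "|B| =o t"
    by (rule ordIso_transitive[OF ordIso_symmetric[OF B(1)] card_of_Field_ordIso[OF assms(1)]])
  then show thesis
    by (rule that[OF card_of_Card_order])
qed

lemma Card_order_le_UNIV: "Card_order (r :: 'k rel) \<Longrightarrow> r \<le>o |UNIV :: 'k set|"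
  by (rule ordIso_ordLeq_trans[OF ordIso_symmetric[OF card_of_Field_ordIso] card_of_mono1[OF subset_UNIV]])

lemma card_Sup:
  fixes R :: "'k rel set"
  assumes "\<And>r. r \<in> R \<Longrightarrow> Card_order r"
  shows Card_order_card_Sup: "Card_order (card_Sup R)"
    and card_Sup_upper: "\<And>s. s \<in> R \<Longrightarrow> s \<le>o card_Sup R"
    and card_Sup_least: "\<And>t :: 'b rel. Card_order t \<Longrightarrow> (\<And>s. s \<in> R \<Longrightarrow> s \<le>o t) \<Longrightarrow> card_Sup R \<le>o t"
proof -
  let ?S = "{r :: 'k rel. Card_order r \<and> (\<forall>s\<in>R. s \<le>o r)}"
  have U: "|UNIV :: 'k set| \<in> ?S"
    using assms Card_order_le_UNIV card_of_Card_order by blast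
  then have ne: "?S \<noteq> {}" by blast
  have "card_Sup R \<in> ?S"
    unfolding card_Sup_def by (rule card_Min_in[OF ne]) simp
  then show C: "Card_order (card_Sup R)" and "\<And>s. s \<in> R \<Longrightarrow> s \<le>o card_Sup R"
    by auto
  have min: "card_Sup R \<le>o r" if "r \<in> ?S" for r
    unfolding card_Sup_def by (rule card_Min_le[OF ne _ that]) simp
  show "card_Sup R \<le>o t" if t: "Card_order t" "\<And>s. s \<in> R \<Longrightarrow> s \<le>o t" for t :: "'b rel"
  proof (cases "t \<le>o card_Sup R")
    case True
    obtain t' :: "'k rel" where t': "Card_order t'" "t' =o t"
      using Card_order_representative[OF t(1) C True] by blast
    have "t' \<in> ?S"
      using t'(1) ordLeq_ordIso_trans[OF t(2) ordIso_symmetric[OF t'(2)]] by simp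
    then show ?thesis
      by (rule ordLeq_ordIso_trans[OF min t'(2)])
  next
    case False
    then show ?thesis
      using ordLeq_total[of t "card_Sup R"] C t(1) by (auto dest: card_order_on_well_order_on)
  qed
qed

lemma Hausdorff_number:
  fixes X :: "'a topology"
  shows Card_order_Hausdorff_number: "Card_order (Hausdorff_number X)"
    and Hausdorff_number_separating:
      "\<And>A. A \<subseteq> topspace X \<Longrightarrow> Hausdorff_number X \<le>o |A| \<Longrightarrow> points_separated X A"
    and Hausdorff_number_least:
      "\<And>k :: 'b rel. Card_order k \<Longrightarrow>
         (\<And>A. A \<subseteq> topspace X \<Longrightarrow> k \<le>o |A| \<Longrightarrow> points_separated X A) \<Longrightarrow> Hausdorff_number X \<le>o k"
proof -
  let ?S = "{k :: 'a set rel. Card_order k \<and>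
    (\<forall>A. A \<subseteq> topspace X \<and> k \<le>o |A| \<longrightarrow> points_separated X A)}"
  have "\<not> cardSuc |topspace X| \<le>o |A|" if "A \<subseteq> topspace X" for A
    using not_ordLess_ordLeq[OF cardSuc_greater[OF card_of_Card_order]]
      ordLeq_transitive[OF _ card_of_mono1[OF that]] by (rule contrapos_nn)
  then have "cardSuc |topspace X| \<in> ?S"
    using cardSuc_Card_order[OF card_of_Card_order, of "topspace X"] by blast
  then have ne: "?S \<noteq> {}" by blast
  have "Hausdorff_number X \<in> ?S"
    unfolding Hausdorff_number_def by (rule card_Min_in[OF ne]) simp
  then show C: "Card_order (Hausdorff_number X)"
    and "\<And>A. A \<subseteq> topspace X \<Longrightarrow> Hausdorff_number X \<le>o |A| \<Longrightarrow> points_separated X A"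
    by auto
  have min: "Hausdorff_number X \<le>o r" if "r \<in> ?S" for r
    unfolding Hausdorff_number_def by (rule card_Min_le[OF ne _ that]) simp
  show "Hausdorff_number X \<le>o k"
    if k: "Card_order k" "\<And>A. A \<subseteq> topspace X \<Longrightarrow> k \<le>o |A| \<Longrightarrow> points_separated X A" for k :: "'b rel"
  proof (cases "k \<le>o Hausdorff_number X")
    case True
    obtain k' :: "'a set rel" where k': "Card_order k'" "k' =o k"
      using Card_order_representative[OF k(1) C True] by blast
    have "k' \<in> ?S"
      using k'(1) k(2)[OF _ ordIso_ordLeq_trans[OF ordIso_symmetric[OF k'(2)]]] by simp
    then show ?thesis
      by (rule ordLeq_ordIso_trans[OF min k'(2)])
  next
    case False
    then show ?thesis
      using ordLeq_total[of k "Hausdorff_number X"] C k(1) by (auto dest: card_order_on_well_order_on)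
  qed
qed

lemma pi_character_at:
  assumes "x \<in> topspace X"
  shows pi_character_at_attained: "\<exists>\<B>. local_pi_base X x \<B> \<and> pi_character_at X x = |\<B>|"
    and pi_character_at_le: "\<And>\<B>. local_pi_base X x \<B> \<Longrightarrow> pi_character_at X x \<le>o |\<B>|"
proof -
  let ?R = "card_of ` {\<B>. local_pi_base X x \<B>}"
  have "local_pi_base X x {B. openin X B \<and> B \<noteq> {}}"
    unfolding local_pi_base_def by blast
  then have ne: "?R \<noteq> {}" by blast
  have "pi_character_at X x \<in> ?R"
    unfolding pi_character_at_def by (rule card_Min_in[OF ne]) (auto simp: card_of_Card_order)
  then show "\<exists>\<B>. local_pi_base X x \<B> \<and> pi_character_at X x = |\<B>|" by blast
  show "pi_character_at X x \<le>o |\<B>|" if "local_pi_base X x \<B>" for \<B>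
    unfolding pi_character_at_def
    by (rule card_Min_le[OF ne]) (use that in \<open>auto simp: card_of_Card_order\<close>)
qed

end

theory Submission
  imports Defs "HOL-Library.Ramsey"
begin

text \<open>
  Fix a point \<open>p\<close>, a small local \<open>\<pi>\<close>-base \<open>\<B>\<close> at \<open>p\<close> and homeomorphisms \<open>h x\<close> carrying \<open>p\<close> to \<open>x\<close>. Separating a
  triple of points and pulling back to \<open>p\<close> gives a member of \<open>\<B>\<close> whose three images under \<open>h\<close> have
  empty intersection; this colours the triples by \<open>\<B>\<close>. If the space were too large, the Erdos-Rado theorem
  \<open>(2^(2^\<kappa>))\<^sup>+ \<rightarrow> (\<kappa>\<^sup>+)\<^sup>3\<^sub>\<kappa>\<close> with \<open>\<kappa> = c(X) \<pi>\<chi>(X)\<close> would yield one \<open>B \<in> \<B>\<close> and more than \<open>\<kappa>\<close> points \<open>x\<close> such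
  that the open sets \<open>h x ` B\<close> have no point in common to any three of them. The nonempty pairwise
  intersections then form a cellular family, as do the sets that meet no other, so there are at most
  \<open>\<kappa>\<close> sets in all.
\<close>

section \<open>Cardinal bounds for power sets and sets of finite subsets\<close>

lemma card_of_Pow_ordLeq_cexp:
  assumes "Card_order k" "|A| \<le>o k"
  shows "|Pow A| \<le>o ctwo ^c k"
proof -
  have "|A| \<le>o |Field k|"
    using assms card_of_Field_ordIso ordIso_symmetric ordLeq_ordIso_trans by blast
  then obtain f where f: "inj_on f A" "f ` A \<subseteq> Field k"
    using card_of_ordLeq[of A "Field k"] by blast
  have "inj_on (image f) (Pow A)" "image f ` Pow A \<subseteq> Pow (Field k)"
    using f by (auto intro!: inj_on_image_Pow)
  then have "|Pow A| \<le>o |Pow (Field k)|"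
    using card_of_ordLeq[of "Pow A"] by blast
  also have "|Pow (Field k)| =o ctwo ^c k"
    using card_of_Pow_Func[of "Field k"] by (simp add: cexp_def ctwo_def Field_card_of)
  finally show ?thesis .
qed

lemma card_of_nsets_ordLeq:
  assumes k: "Cinfinite k" and A: "|A| \<le>o k"
  shows "|[A]\<^bsup>n\<^esup>| \<le>o k"
proof (induction n)
  case 0
  have "Field k \<noteq> {}" using k by (auto simp: cinfinite_def)
  then show ?case
    using k Card_order_singl_ordLeq[of k "{}"] by simp
next
  case (Suc n)
  have "[A]\<^bsup>Suc n\<^esup> \<subseteq> (\<lambda>(x, T). insert x T) ` (A \<times> [A]\<^bsup>n\<^esup>)"
  proof
    fix T assume "T \<in> [A]\<^bsup>Suc n\<^esup>"
    then obtain x S where "T = insert x S" "x \<notin> S" "card S = n" "finite S" "insert x S \<subseteq> A"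
      by (auto simp: nsets_def card_Suc_eq_finite)
    then show "T \<in> (\<lambda>(x, T). insert x T) ` (A \<times> [A]\<^bsup>n\<^esup>)"
      by (auto simp: nsets_def)
  qed
  then have "|[A]\<^bsup>Suc n\<^esup>| \<le>o |A \<times> [A]\<^bsup>n\<^esup>|"
    using card_of_image card_of_mono1 ordLeq_transitive by blast
  moreover have "|A \<times> [A]\<^bsup>n\<^esup>| \<le>o k"
    using k A Suc card_of_Times_ordLeq_infinite_Field by (auto simp: cinfinite_def)
  ultimately show ?case
    by (rule ordLeq_transitive)
qed

section \<open>End-homogeneous sequences\<close>

text \<open>\<open>F\<close> sees only the set of earlier values, so two recursions with the same
  \<open>F\<close>-value on equal sets of predecessors make the same next choice.\<close>

lemma Well_order_initial_segments_recursion: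
  assumes "Well_order r"
  obtains g where "\<And>i. g i = F (g ` underS r i)"
proof -
  have wf: "wf (r - Id)"
    using assms by (simp add: well_order_on_def)
  define g where "g = wfrec (r - Id) (\<lambda>h i. F (h ` underS r i))"
  have "cut g (r - Id) i ` underS r i = g ` underS r i" for i
    by (rule image_cong) (auto simp: underS_def cut_apply)
  then have "g i = F (g ` underS r i)" for i
    using wfrec[OF wf, of "\<lambda>h i. F (h ` underS r i)" i] by (simp add: g_def)
  then show thesis by (rule that)
qed

text \<open>
  Each \<open>x \<in> A\<close> determines a branch \<open>g x\<close>, whose \<open>i\<close>-th entry is a new element chosen among those
  having the same type as \<open>x\<close> over the earlier entries. As the choice depends only on this type, a
  branch that meets \<open>x\<close> at \<open>i\<close> is determined by \<open>i\<close> and by a subset of a set of size at most \<open>k\<close>, and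
  since \<open>A\<close> is large, some branch misses its \<open>x\<close>.
\<close>

lemma end_homogeneous_sequence:
  fixes A :: "'a set" and k :: "'k rel"
  assumes k: "Cinfinite k" and A: "ctwo ^c k <o |A|"
    and C: "|C| \<le>o k" and f: "f ` [A]\<^bsup>Suc n\<^esup> \<subseteq> C"
  obtains g x where "x \<in> A" "inj_on g (Field (cardSuc k))" "g ` Field (cardSuc k) \<subseteq> A - {x}"
    "\<And>i T. i \<in> Field (cardSuc k) \<Longrightarrow> T \<in> [g ` underS (cardSuc k) i]\<^bsup>n\<^esup> \<Longrightarrow>
      f (insert (g i) T) = f (insert x T)"
proof -
  let ?r = "cardSuc k"
  have r: "Card_order ?r" "Well_order ?r"
    using k cardSuc_Card_order card_order_on_well_order_on by blast+
  have wf: "wf (?r - Id)"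
    using r by (simp add: well_order_on_def)
  have trans: "j \<in> underS ?r i \<Longrightarrow> l \<in> underS ?r j \<Longrightarrow> l \<in> underS ?r i" for i j l
    using r by (auto simp: underS_def order_on_defs dest: transD antisymD)
  \<comment> \<open>The candidates for extending \<open>S\<close>: new elements with the same type
    as \<open>x\<close> over \<open>S\<close>.\<close>
  define E where "E x S a \<longleftrightarrow> a \<in> A \<and> a \<notin> S \<and> (\<forall>T\<in>[S]\<^bsup>n\<^esup>. f (insert a T) = f (insert x T))" for x S a
  have "\<exists>g. \<forall>i. g i = (SOME a. E x (g ` underS ?r i) a)" for x
    by (rule Well_order_initial_segments_recursion[OF r(2), of "\<lambda>S. SOME a. E x S a"]) blast
  then obtain g where g: "\<And>x i. g x i = (SOME a. E x (g x ` underS ?r i) a)"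
    by metis
  \<comment> \<open>As long as the branch has not reached \<open>x\<close>, the point
    \<open>x\<close> itself is a candidate, so the choice is legitimate.\<close>
  have good: "E x (g x ` underS ?r i) (g x i)" if "x \<in> A" "x \<notin> g x ` underS ?r i" for x i
    unfolding g[of x i] by (rule someI[of _ x]) (use that in \<open>simp add: E_def\<close>)
  show thesis
  proof (cases "\<exists>x\<in>A. x \<notin> g x ` Field ?r")
    case True
    then obtain x where x: "x \<in> A" "x \<notin> g x ` Field ?r" by blast
    have E: "E x (g x ` underS ?r i) (g x i)" if "i \<in> Field ?r" for i
      using x that by (intro good) (auto simp: underS_def Field_def)
    have "inj_on (g x) (Field ?r)"
    proof (rule inj_onI, rule ccontr)
      fix i j assume ij: "i \<in> Field ?r" "j \<in> Field ?r" "g x i = g x j" "i \<noteq> j"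
      then have "i \<in> underS ?r j \<or> j \<in> underS ?r i"
        using r(2) by (auto simp: underS_def order_on_defs total_on_def)
      then show False
        using E[OF ij(1)] E[OF ij(2)] ij(3) unfolding E_def by (metis imageI)
    qed
    moreover have "g x ` Field ?r \<subseteq> A - {x}"
      using E x(2) unfolding E_def by blast
    ultimately show thesis
      using E x(1) by (intro that[of x "g x"]) (auto simp: E_def)
  next
    \<comment> \<open>Every branch reaches its point. Then \<open>A\<close> injects into pairs of an
      index and a type, which are too few.\<close>
    case False
    have "\<exists>i\<in>Field ?r. g x i = x \<and> x \<notin> g x ` underS ?r i" if "x \<in> A" for x
    proof -
      \<comment> \<open>The least index in \<open>?Q\<close> is the first time the branch reaches
        \<open>x\<close>, so all entries before it are legitimate choices.\<close>
      let ?Q = "{i \<in> Field ?r. g x i = x}"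
      have "x \<in> g x ` Field ?r"
        using False that by blast
      then obtain j where j: "x = g x j" "j \<in> Field ?r"
        by (rule imageE)
      then have "j \<in> ?Q"
        by (intro CollectI conjI j(1)[symmetric])
      then obtain i where i: "i \<in> ?Q" and min: "\<And>j. (j, i) \<in> ?r - Id \<Longrightarrow> j \<notin> ?Q"
        by (rule wfE_min[OF wf]) (rule that)
      have "x \<notin> g x ` underS ?r i"
      proof
        assume "x \<in> g x ` underS ?r i"
        then obtain j where j: "x = g x j" "j \<in> underS ?r i"
          by (rule imageE)
        then have "(j, i) \<in> ?r - Id" "j \<in> Field ?r"
          by (auto simp: underS_def Field_def)
        then show False
          using min[of j] j(1)[symmetric] by blast
      qed
      then show ?thesis using i by blast
    qed
    then obtain i where i: "\<And>x. x \<in> A \<Longrightarrow> i x \<in> Field ?r" "\<And>x. x \<in> A \<Longrightarrow> g x (i x) = x"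
      and new: "\<And>x. x \<in> A \<Longrightarrow> x \<notin> g x ` underS ?r (i x)"
      by metis
    have branch: "g x ` underS ?r (i x) \<subseteq> A" if "x \<in> A" for x
    proof (rule image_subsetI)
      fix j assume "j \<in> underS ?r (i x)"
      then have "x \<notin> g x ` underS ?r j"
        using new[OF that] trans by blast
      then show "g x j \<in> A"
        using good[OF that] by (simp add: E_def)
    qed
    \<comment> \<open>The type is recorded over sets of indices rather than of entries, so that
      types along different branches can be compared before the branches are known to agree.\<close>
    define t where "t x = {(T, c). T \<in> [underS ?r (i x)]\<^bsup>n\<^esup> \<and> c \<in> C \<and> f (insert x (g x ` T)) = c}" for x
    have type_eq: "f (insert y (g x ` U)) = f (insert x (g x ` U))"
      if xy: "x \<in> A" "i x = i y" "t x = t y"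
        and U: "U \<subseteq> underS ?r (i x)" "finite U" "card U = n" "inj_on (g x) U"
        and g_eq: "\<forall>j\<in>U. g x j = g y j" for x y U
    proof -
      have "x \<notin> g x ` U" "g x ` U \<subseteq> A"
        using new[OF xy(1)] branch[OF xy(1)] U(1) by blast+
      then have "insert x (g x ` U) \<in> [A]\<^bsup>Suc n\<^esup>"
        using xy(1) U by (simp add: nsets_def card_image)
      then have "(U, f (insert x (g x ` U))) \<in> t x"
        using U f by (auto simp: t_def nsets_def)
      then have "(U, f (insert x (g x ` U))) \<in> t y"
        using xy(3) by simp
      then have "f (insert y (g y ` U)) = f (insert x (g x ` U))"
        by (simp add: t_def)
      moreover have "g y ` U = g x ` U"
        using g_eq by auto
      ultimately show ?thesis by simp
    qed
    have inj: "inj_on (\<lambda>x. (i x, t x)) A"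
    proof (rule inj_onI)
      fix x y assume xy: "x \<in> A" "y \<in> A" and "(i x, t x) = (i y, t y)"
      then have eq: "i x = i y" "t x = t y" by auto
      \<comment> \<open>Where the earlier entries agree, equal types make the two candidate
        predicates equal, hence also the chosen entries. The index \<open>i x\<close> is included
        because the branches arrive at \<open>x\<close> and \<open>y\<close> there.\<close>
      have same_branch: "j \<in> insert (i x) (underS ?r (i x)) \<Longrightarrow> g x j = g y j" for j
      proof (induction j rule: wf_induct_rule[OF wf])
        case (1 j)
        have sub: "underS ?r j \<subseteq> underS ?r (i x)"
          using 1(2) trans by blast
        have same: "g x l = g y l" if "l \<in> underS ?r j" for l
          using 1(1)[of l] that sub by (auto simp: underS_def)
        then have S: "g x ` underS ?r j = g y ` underS ?r j" by auto
        have "f (insert y T) = f (insert x T)" if T: "T \<in> [g x ` underS ?r j]\<^bsup>n\<^esup>" for T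
        proof -
          obtain U where "U \<subseteq> underS ?r j" "inj_on (g x) U" "T = g x ` U"
            using T by (auto simp: nsets_def subset_image_inj)
          then show ?thesis
            using T sub same
            by (auto intro!: type_eq[OF xy(1) eq] simp: nsets_def card_image finite_image_iff)
        qed
        then have "E x (g x ` underS ?r j) = E y (g x ` underS ?r j)"
          by (auto simp: E_def fun_eq_iff)
        then show ?case
          unfolding g[of x j] g[of y j] S by simp
      qed
      have "x = g x (i x)"
        by (rule i(2)[OF xy(1), symmetric])
      also have "\<dots> = g y (i y)"
        using same_branch[of "i x"] eq(1) by simp
      also have "\<dots> = y"
        by (rule i(2)[OF xy(2)])
      finally show "x = y" .
    qed
    let ?P = "\<lambda>i. Pow ([underS ?r i]\<^bsup>n\<^esup> \<times> C)"
    have two: "Cinfinite (ctwo ^c k)"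
      using k Cinfinite_cexp[OF ordLeq_refl[OF Card_order_ctwo]] by blast
    \<comment> \<open>Proper initial segments of \<open>cardSuc k\<close> have size at most
      \<open>k\<close>, so each index admits at most \<open>ctwo ^c k\<close> types. There are also
      at most \<open>ctwo ^c k\<close> indices.\<close>
    have "|[underS ?r i]\<^bsup>n\<^esup> \<times> C| \<le>o k" if "i \<in> Field ?r" for i
    proof -
      have "|underS ?r i| \<le>o k"
        using card_of_underS[OF r(1) that] k cardSuc_ordLeq_ordLess[of k "|underS ?r i|"]
        by (simp add: card_of_Card_order)
      then have "|[underS ?r i]\<^bsup>n\<^esup>| \<le>o k"
        by (rule card_of_nsets_ordLeq[OF k])
      then show ?thesis
        using k C by (intro card_of_Times_ordLeq_infinite_Field) (simp_all add: cinfinite_def)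
    qed
    then have "\<forall>i\<in>Field ?r. |?P i| \<le>o ctwo ^c k"
      using card_of_Pow_ordLeq_cexp k by blast
    moreover have "|Field ?r| \<le>o ctwo ^c k"
      using r(1) k ordLess_ctwo_cexp[of k] cardSuc_least[of k "ctwo ^c k"] Card_order_cexp
        card_of_Field_ordIso ordIso_ordLeq_trans by blast
    ultimately have "|Sigma (Field ?r) ?P| \<le>o ctwo ^c k"
      using two by (intro card_of_Sigma_ordLeq_infinite_Field) (simp_all add: cinfinite_def)
    moreover have "(\<lambda>x. (i x, t x)) ` A \<subseteq> Sigma (Field ?r) ?P"
      using i(1) by (auto simp: t_def)
    then have "|A| \<le>o |Sigma (Field ?r) ?P|"
      using inj card_of_ordLeq by blast
    ultimately show thesis
      using A ordLeq_transitive not_ordLess_ordLeq by blast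
  qed
qed

section \<open>The Erdos-Rado theorem for exponents one to three\<close>

lemma infinite_pigeonhole:
  assumes k: "Cinfinite k" and A: "k <o |A|" and C: "|C| \<le>o k" and f: "f ` A \<subseteq> C"
  obtains c where "c \<in> C" "k <o |{a \<in> A. f a = c}|"
proof (rule ccontr)
  assume "\<not> thesis"
  then have "\<forall>c\<in>C. |{a \<in> A. f a = c}| \<le>o k"
    using that k not_ordLess_iff_ordLeq[OF card_of_Well_order] card_order_on_well_order_on by blast
  then have "|\<Union>c\<in>C. {a \<in> A. f a = c}| \<le>o k"
    using k C by (intro card_of_UNION_ordLeq_infinite_Field) (auto simp: cinfinite_def)
  moreover have "A = (\<Union>c\<in>C. {a \<in> A. f a = c})"
    using f by auto
  ultimately show False
    using A not_ordLess_ordLeq by metis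
qed

lemma finite_has_last:
  assumes "Well_order r" "finite I" "I \<noteq> {}" "I \<subseteq> Field r"
  shows "\<exists>i\<in>I. \<forall>j\<in>I. j = i \<or> j \<in> underS r i"
  using assms(2-4)
proof (induction I rule: finite_ne_induct)
  case (singleton i)
  then show ?case by simp
next
  case (insert x I)
  then obtain i where i: "i \<in> I" "\<forall>j\<in>I. j = i \<or> j \<in> underS r i" by auto
  have "x \<noteq> i" "x \<in> Field r" "i \<in> Field r"
    using insert.hyps insert.prems i(1) by auto
  then have "(x, i) \<in> r \<or> (i, x) \<in> r"
    using assms(1) by (auto simp: order_on_defs total_on_def)
  then consider "x \<in> underS r i" | "i \<in> underS r x"
    using \<open>x \<noteq> i\<close> by (auto simp: underS_def)
  then show ?case
  proof cases
    case 1
    then show ?thesis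
      using i by (intro bexI[of _ i]) auto
  next
    case 2
    have "trans r" "antisym r"
      using assms(1) by (auto simp: order_on_defs)
    then have "j \<in> underS r x" if "j \<in> underS r i" for j
      using that 2 by (auto simp: underS_def dest: transD antisymD)
    then show ?thesis
      using i 2 by (intro bexI[of _ x]) auto
  qed
qed

text \<open>Along an end-homogeneous sequence the last entry of a set may be replaced by the fixed
  point \<open>x\<close>. The colouring of \<open>Suc n\<close>-sets thereby reduces to the
  colouring \<open>f (insert x T)\<close> of \<open>n\<close>-sets. The size bound \<open>l\<close>
  is kept free, as it may lie below \<open>k\<close>.\<close>

lemma erdos_rado_step:
  fixes A :: "'a set" and k :: "'k rel"
  assumes k: "Cinfinite k" and A: "ctwo ^c k <o |A|"
    and C: "|C| \<le>o k" and f: "f ` [A]\<^bsup>Suc n\<^esup> \<subseteq> C"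
    and step: "\<And>(B :: 'a set) g. k <o |B| \<Longrightarrow> g ` [B]\<^bsup>n\<^esup> \<subseteq> C \<Longrightarrow>
      \<exists>H\<subseteq>B. l <o |H| \<and> (\<exists>c\<in>C. \<forall>T\<in>[H]\<^bsup>n\<^esup>. g T = c)"
  shows "\<exists>H\<subseteq>A. l <o |H| \<and> (\<exists>c\<in>C. \<forall>T\<in>[H]\<^bsup>Suc n\<^esup>. f T = c)"
proof -
  let ?r = "cardSuc k"
  have r: "Card_order ?r" "Well_order ?r"
    using k cardSuc_Card_order card_order_on_well_order_on by blast+
  obtain g x where x: "x \<in> A" and g: "inj_on g (Field ?r)" "g ` Field ?r \<subseteq> A - {x}"
    and end_hom: "\<And>i T. i \<in> Field ?r \<Longrightarrow> T \<in> [g ` underS ?r i]\<^bsup>n\<^esup> \<Longrightarrow> f (insert (g i) T) = f (insert x T)"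
    by (rule end_homogeneous_sequence[OF k A C f]) (rule that)
  let ?B = "g ` Field ?r"
  have "?r =o |?B|"
    using card_of_ordIso[of "Field ?r" ?B] g(1) inj_on_imp_bij_betw card_of_Field_ordIso[OF r(1)]
      ordIso_symmetric ordIso_transitive by blast
  then have "k <o |?B|"
    using cardSuc_greater[of k] k ordLess_ordIso_trans by blast
  moreover have "(\<lambda>T. f (insert x T)) ` [?B]\<^bsup>n\<^esup> \<subseteq> C"
  proof (rule image_subsetI)
    \<comment> \<open>Since the sequence avoids \<open>x\<close>, adding \<open>x\<close> really
      gives \<open>Suc n\<close> elements.\<close>
    fix T assume "T \<in> [?B]\<^bsup>n\<^esup>"
    moreover from this have "x \<notin> T" "T \<subseteq> A"
      using g(2) unfolding nsets_def by blast+
    ultimately have "insert x T \<in> [A]\<^bsup>Suc n\<^esup>"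
      using x by (simp add: nsets_def)
    then show "f (insert x T) \<in> C" using f by blast
  qed
  ultimately have "\<exists>H\<subseteq>?B. l <o |H| \<and> (\<exists>c\<in>C. \<forall>T\<in>[H]\<^bsup>n\<^esup>. f (insert x T) = c)"
    by (rule step)
  then obtain H c where H: "H \<subseteq> ?B" "l <o |H|" "c \<in> C" "\<And>T. T \<in> [H]\<^bsup>n\<^esup> \<Longrightarrow> f (insert x T) = c"
    by blast
  have "f T = c" if T: "T \<in> [H]\<^bsup>Suc n\<^esup>" for T
  proof -
    obtain I where I: "I \<subseteq> Field ?r" "inj_on g I" "T = g ` I"
      using T H(1) subset_image_inj[of T g "Field ?r"] by (auto simp: nsets_def)
    then have card: "finite I" "card I = Suc n"
      using T by (auto simp: nsets_def card_image finite_image_iff)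
    have "I \<noteq> {}" using card by auto
    \<comment> \<open>With \<open>i\<close> the last index of \<open>T\<close>, all other entries
      lie over \<open>underS ?r i\<close>, so end-homogeneity applies to them.\<close>
    obtain i where i: "i \<in> I" "\<And>j. j \<in> I \<Longrightarrow> j = i \<or> j \<in> underS ?r i"
      using finite_has_last[OF r(2) card(1) \<open>I \<noteq> {}\<close> I(1)] by blast
    let ?T = "g ` (I - {i})"
    have "?T \<in> [g ` underS ?r i]\<^bsup>n\<^esup>" "?T \<in> [H]\<^bsup>n\<^esup>"
      using i card I T by (auto simp: nsets_def card_image inj_on_diff)
    moreover have "T = insert (g i) ?T"
      using i(1) I(3) by blast
    ultimately show ?thesis
      using end_hom[of i ?T] H(4)[of ?T] i(1) I(1) by auto
  qed
  moreover have "H \<subseteq> A"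
    using H(1) g(2) by blast
  ultimately show ?thesis
    using H(2,3) by (intro exI[of _ H] conjI bexI[of _ c] ballI)
qed

lemma erdos_rado_1:
  assumes "Cinfinite k" "k <o |A|" "|C| \<le>o k" "f ` [A]\<^bsup>1\<^esup> \<subseteq> C"
  shows "\<exists>H\<subseteq>A. k <o |H| \<and> (\<exists>c\<in>C. \<forall>T\<in>[H]\<^bsup>1\<^esup>. f T = c)"
proof -
  have "(\<lambda>a. f {a}) ` A \<subseteq> C"
    using assms(4) by (auto simp: nsets_one)
  from infinite_pigeonhole[OF assms(1-3) this]
  obtain c where "c \<in> C" "k <o |{a \<in> A. f {a} = c}|" .
  then show ?thesis
    by (intro exI[of _ "{a \<in> A. f {a} = c}"]) (auto simp: nsets_one)
qed

lemma erdos_rado_2: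
  assumes k: "Cinfinite k" and "ctwo ^c k <o |A|" and C: "|C| \<le>o k" and "f ` [A]\<^bsup>2\<^esup> \<subseteq> C"
  shows "\<exists>H\<subseteq>A. k <o |H| \<and> (\<exists>c\<in>C. \<forall>T\<in>[H]\<^bsup>2\<^esup>. f T = c)"
  using erdos_rado_step[OF k assms(2) C, where n = 1, unfolded Suc_1] assms(4) erdos_rado_1[OF k _ C]
  by blast

text \<open>Raising the exponent costs one exponential: the step is applied at
  \<open>ctwo ^c k\<close>, with the case of pairs at \<open>k\<close> supplying the homogeneous set
  and \<open>l = k\<close>.\<close>

lemma erdos_rado_3:
  assumes k: "Cinfinite k" and "ctwo ^c (ctwo ^c k) <o |A|" and C: "|C| \<le>o k" and "f ` [A]\<^bsup>3\<^esup> \<subseteq> C"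
  shows "\<exists>H\<subseteq>A. k <o |H| \<and> (\<exists>c\<in>C. \<forall>T\<in>[H]\<^bsup>3\<^esup>. f T = c)"
proof -
  have "Cinfinite (ctwo ^c k)"
    using k Cinfinite_cexp[OF ordLeq_refl[OF Card_order_ctwo]] by blast
  moreover have "|C| \<le>o ctwo ^c k"
    using C ordLess_ctwo_cexp[of k] k ordLess_imp_ordLeq ordLeq_transitive by blast
  moreover have "Suc 2 = 3" by simp
  ultimately show ?thesis
    using erdos_rado_step[of "ctwo ^c k" A C f 2 k] assms(2,4) erdos_rado_2[OF k _ C]
    by metis
qed

section \<open>Open families in which no three members meet\<close>

lemma card_ordLeq_if_triples_disjoint:
  assumes k: "Cinfinite k" and cell: "\<And>\<U>. cellular_family X \<U> \<Longrightarrow> |\<U>| \<le>o k"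
    and V: "\<And>x. x \<in> H \<Longrightarrow> openin X (V x) \<and> V x \<noteq> {}"
    and triples: "\<And>T. T \<in> [H]\<^bsup>3\<^esup> \<Longrightarrow> (\<Inter>x\<in>T. V x) = {}"
  shows "|H| \<le>o k"
proof -
  \<comment> \<open>Nonempty disjoint sets have distinct indices, so the cellularity bound passes to
    the index set.\<close>
  have indexed: "|I| \<le>o k"
    if W: "\<And>i. i \<in> I \<Longrightarrow> openin X (W i) \<and> W i \<noteq> {}"
      and disj: "\<And>i j. i \<in> I \<Longrightarrow> j \<in> I \<Longrightarrow> i \<noteq> j \<Longrightarrow> W i \<inter> W j = {}" for I :: "'i set" and W
  proof -
    have "inj_on W I"
      using W disj by (metis inf.idem inj_onI)
    then have "|I| \<le>o |W ` I|"
      using card_of_ordLeq by blast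
    moreover have "cellular_family X (W ` I)"
      using W disj by (auto simp: cellular_family_def pairwise_def disjnt_def)
    ultimately show ?thesis
      using cell ordLeq_transitive by blast
  qed
  define E where "E = {P \<in> [H]\<^bsup>2\<^esup>. (\<Inter>x\<in>P. V x) \<noteq> {}}"
  have "|E| \<le>o k"
  proof (rule indexed)
    fix P assume "P \<in> E"
    then show "openin X (\<Inter>x\<in>P. V x) \<and> (\<Inter>x\<in>P. V x) \<noteq> {}"
      using V by (auto simp: E_def nsets_2_eq intro!: openin_Int)
  next
    fix P Q assume PQ: "P \<in> E" "Q \<in> E" "P \<noteq> Q"
    then have "P \<subseteq> H" "Q \<subseteq> H" "card P = 2" "card Q = 2" "finite P" "finite Q"
      by (auto simp: E_def nsets_def)
    \<comment> \<open>Two distinct pairs span at least three points, so a common point of both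
      intersections would lie in a triple intersection.\<close>
    then obtain z where z: "z \<in> Q" "z \<notin> P"
      using PQ(3) by (metis card_subset_eq subsetI)
    then have "insert z P \<in> [H]\<^bsup>3\<^esup>"
      using \<open>P \<subseteq> H\<close> \<open>Q \<subseteq> H\<close> \<open>card P = 2\<close> \<open>finite P\<close> by (auto simp: nsets_def)
    from triples[OF this] show "(\<Inter>x\<in>P. V x) \<inter> (\<Inter>x\<in>Q. V x) = {}"
      using z(1) by blast
  qed
  moreover have "|P| \<le>o k" if "P \<in> E" for P
    using that k by (intro ordLess_imp_ordLeq[OF Cfinite_ordLess_Cinfinite])
      (auto simp: E_def nsets_def cfinite_def Field_card_of card_of_card_order_on)
  ultimately have "|\<Union>P\<in>E. P| \<le>o k"
    using k by (intro card_of_UNION_ordLeq_infinite_Field) (auto simp: cinfinite_def)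
  \<comment> \<open>Points outside every pair of \<open>E\<close> index pairwise disjoint sets, so
    \<open>indexed\<close> applies a second time.\<close>
  moreover have "|H - (\<Union>P\<in>E. P)| \<le>o k"
  proof (rule indexed)
    show "openin X (V x) \<and> V x \<noteq> {}" if "x \<in> H - (\<Union>P\<in>E. P)" for x
      using V that by blast
    show "V x \<inter> V y = {}" if "x \<in> H - (\<Union>P\<in>E. P)" "y \<in> H - (\<Union>P\<in>E. P)" "x \<noteq> y" for x y
    proof (rule ccontr)
      assume "V x \<inter> V y \<noteq> {}"
      then have "{x, y} \<in> E"
        using that by (simp add: E_def)
      then show False using that(1) by blast
    qed
  qed
  ultimately have "|(\<Union>P\<in>E. P) \<union> (H - (\<Union>P\<in>E. P))| \<le>o k"
    using k Un_Cinfinite_bound by blast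
  then show ?thesis
    using card_of_mono1[of H "(\<Union>P\<in>E. P) \<union> (H - (\<Union>P\<in>E. P))"] ordLeq_transitive by blast
qed

section \<open>Cellularity and pi-character as infinite upper bounds\<close>

lemma ordLeq_cprod1:
  assumes "Card_order p" "Cnotzero q"
  shows "p \<le>o p *c q"
  using ordLeq_cprod2[OF assms(2,1)] cprod_com ordLeq_ordIso_trans by blast

text \<open>The nonempty \<open>A\<close> keeps \<open>t\<close> nonzero; a zero factor would make
  the product zero.\<close>

lemma Cinfinite_cprod_natLeq:
  assumes "Card_order t" "|A| \<le>o t" "A \<noteq> {}"
  shows "Cinfinite (t *c natLeq)"
proof -
  have "Cnotzero |A|"
    using assms(3) by (simp add: card_of_Card_order card_of_ordIso_czero_iff_empty)
  then show ?thesis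
    using Cnotzero_mono assms(1,2) Cinfinite_cprod2 natLeq_Cinfinite by blast
qed

lemma cellularity:
  shows card_cellular_family_ordLeq: "cellular_family X \<U> \<Longrightarrow> |\<U>| \<le>o cellularity X"
    and Cinfinite_cellularity: "topspace X \<noteq> {} \<Longrightarrow> Cinfinite (cellularity X)"
proof -
  let ?S = "card_Sup (card_of ` {\<U>. cellular_family X \<U>})"
  have S: "Card_order ?S" "\<And>\<U>. cellular_family X \<U> \<Longrightarrow> |\<U>| \<le>o ?S"
    using card_Sup[of "card_of ` {\<U>. cellular_family X \<U>}"] card_of_Card_order by blast+
  show "|\<U>| \<le>o cellularity X" if "cellular_family X \<U>"
    unfolding cellularity_def
    using ordLeq_transitive[OF S(2)[OF that] ordLeq_cprod1[OF S(1) Cinfinite_Cnotzero[OF natLeq_Cinfinite]]] .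
  show "Cinfinite (cellularity X)" if "topspace X \<noteq> {}"
  proof -
    have "cellular_family X {topspace X}"
      using that by (simp add: cellular_family_def)
    then show ?thesis
      unfolding cellularity_def using Cinfinite_cprod_natLeq[OF S(1) S(2)] by blast
  qed
qed

lemma pi_character:
  assumes "x \<in> topspace X"
  shows pi_character_at_ordLeq: "pi_character_at X x \<le>o pi_character X"
    and Cinfinite_pi_character: "Cinfinite (pi_character X)"
proof -
  let ?S = "card_Sup (pi_character_at X ` topspace X)"
  have "Card_order (pi_character_at X x)" if "x \<in> topspace X" for x
    using pi_character_at_attained[OF that] card_of_Card_order by metis
  then have S: "Card_order ?S" "pi_character_at X x \<le>o ?S"
    using card_Sup[of "pi_character_at X ` topspace X"] assms by blast+
  obtain \<B> where B: "local_pi_base X x \<B>" "pi_character_at X x = |\<B>|"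
    using pi_character_at_attained[OF assms] by blast
  \<comment> \<open>The whole space is a neighbourhood of \<open>x\<close> and must contain a member
    of the base.\<close>
  then have "\<B> \<noteq> {}"
    using assms openin_topspace[of X] by (fastforce simp: local_pi_base_def)
  then show "Cinfinite (pi_character X)"
    unfolding pi_character_def
    using Cinfinite_cprod_natLeq[OF S(1)] S(2) B(2) by metis
  show "pi_character_at X x \<le>o pi_character X"
    unfolding pi_character_def
    by (rule ordLeq_transitive[OF S(2) ordLeq_cprod1[OF S(1) Cinfinite_Cnotzero[OF natLeq_Cinfinite]]])
qed

section \<open>Separation of triples pulled back to one point\<close>

lemma three_Hausdorff_points_separated:
  assumes "three_Hausdorff X" "T \<in> [topspace X]\<^bsup>3\<^esup>"
  shows "points_separated X T"
proof -
  have "|{..<3::nat}| =o |T|"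
    using assms(2) finite_same_card_bij[of "{..<3::nat}" T] card_of_ordIso[of "{..<3::nat}" T]
    by (auto simp: nsets_def)
  then have "Hausdorff_number X \<le>o |T|"
    using assms(1) ordLeq_ordIso_trans by (auto simp: three_Hausdorff_def)
  then show ?thesis
    using assms(2) Hausdorff_number_separating by (auto simp: nsets_def)
qed

lemma pi_base_image_INT_empty:
  assumes B: "local_pi_base X p \<B>" and p: "p \<in> topspace X"
    and h: "\<And>x. x \<in> T \<Longrightarrow> continuous_map X X (h x) \<and> h x p = x"
    and T: "finite T" "T \<noteq> {}" and sep: "points_separated X T"
  shows "\<exists>B\<in>\<B>. (\<Inter>x\<in>T. h x ` B) = {}"
proof -
  obtain U where U: "\<And>x. x \<in> T \<Longrightarrow> openin X (U x) \<and> x \<in> U x" "topspace X \<inter> (\<Inter>x\<in>T. U x) = {}"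
    using sep by (auto simp: points_separated_def)
  \<comment> \<open>The points that every \<open>h x\<close> moves into \<open>U x\<close>.
    Finiteness of \<open>T\<close> makes this a neighbourhood of \<open>p\<close>, and a base member
    inside it has its images inside the separating sets.\<close>
  define W where "W = (\<Inter>x\<in>T. {z \<in> topspace X. h x z \<in> U x})"
  have "openin X {z \<in> topspace X. h x z \<in> U x}" if "x \<in> T" for x
    using openin_continuous_map_preimage h[OF that] U(1)[OF that] by blast
  then have "openin X W"
    unfolding W_def using T by blast
  moreover have "p \<in> W"
    using p h U(1) by (auto simp: W_def)
  ultimately obtain B where "B \<in> \<B>" "B \<subseteq> W"
    using B unfolding local_pi_base_def by blast
  then have "h x ` B \<subseteq> U x" if "x \<in> T" for x
    using that by (auto simp: W_def)
  then have "(\<Inter>x\<in>T. h x ` B) \<subseteq> (\<Inter>x\<in>T. U x)"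
    by (rule INT_anti_mono[OF order_refl])
  \<comment> \<open>Separation asserts emptiness only inside the space; as \<open>T\<close> is
    nonempty, the intersection lies there.\<close>
  moreover have "(\<Inter>x\<in>T. U x) \<subseteq> topspace X"
    using T(2) U(1) openin_subset[of X] by (metis INF_lower2 all_not_in_conv)
  ultimately have "(\<Inter>x\<in>T. h x ` B) = {}"
    using U(2) by (metis Int_absorb1 subset_empty)
  then show ?thesis
    using \<open>B \<in> \<B>\<close> by (rule bexI)
qed

theorem theorem3p4:
  fixes X :: "'a topology"
  assumes "three_Hausdorff X"
    and "homogeneous_space X"
  shows "|topspace X| \<le>o ctwo ^c (ctwo ^c (cellularity X *c pi_character X))"
proof (cases "topspace X = {}")
  \<comment> \<open>The empty space has no base point to work from, and infinitude of the cardinals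
    below relies on having points.\<close>
  case True
  then show ?thesis
    using card_of_empty1 Card_order_cexp by (metis card_order_on_well_order_on)
next
  case False
  then obtain p where p: "p \<in> topspace X" by blast
  let ?k = "cellularity X *c pi_character X"
  have c: "Cinfinite (cellularity X)" and \<pi>: "Cinfinite (pi_character X)"
    using Cinfinite_cellularity[OF False] Cinfinite_pi_character[OF p] by auto
  have k: "Cinfinite ?k"
    using Cinfinite_cprod2 Cinfinite_Cnotzero c \<pi> by blast
  have cell: "|\<U>| \<le>o ?k" if "cellular_family X \<U>" for \<U>
    using card_cellular_family_ordLeq[OF that] ordLeq_cprod1[of "cellularity X" "pi_character X"]
      c \<pi> Cinfinite_Cnotzero ordLeq_transitive by blast
  obtain \<B> where B: "local_pi_base X p \<B>" "pi_character_at X p = |\<B>|"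
    using pi_character_at_attained[OF p] by blast
  have card_B: "|\<B>| \<le>o ?k"
    using pi_character_at_ordLeq[OF p] B(2) ordLeq_cprod2[of "cellularity X" "pi_character X"]
      c \<pi> Cinfinite_Cnotzero ordLeq_transitive by metis
  obtain h where h: "\<And>x. x \<in> topspace X \<Longrightarrow> homeomorphic_map X X (h x) \<and> h x p = x"
    using assms(2) p unfolding homogeneous_space_def by metis
  have "\<exists>B\<in>\<B>. (\<Inter>x\<in>T. h x ` B) = {}" if T: "T \<in> [topspace X]\<^bsup>3\<^esup>" for T
    using T h by (intro pi_base_image_INT_empty[OF B(1) p _ _ _ three_Hausdorff_points_separated[OF assms(1) T]])
      (auto simp: nsets_def homeomorphic_imp_continuous_map)
  then obtain f where f: "\<And>T. T \<in> [topspace X]\<^bsup>3\<^esup> \<Longrightarrow> f T \<in> \<B> \<and> (\<Inter>x\<in>T. h x ` f T) = {}"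
    by metis
  show ?thesis
  proof (rule ccontr)
    assume "\<not> ?thesis"
    then have "ctwo ^c (ctwo ^c ?k) <o |topspace X|"
      using not_ordLeq_iff_ordLess[OF _ card_of_Well_order] Card_order_cexp card_order_on_well_order_on by blast
    then obtain H B where H: "H \<subseteq> topspace X" "?k <o |H|" "B \<in> \<B>" "\<And>T. T \<in> [H]\<^bsup>3\<^esup> \<Longrightarrow> f T = B"
      using erdos_rado_3[OF k _ card_B, of "topspace X" f] f by blast
    have "|H| \<le>o ?k"
    proof (rule card_ordLeq_if_triples_disjoint[OF k cell])
      fix x assume "x \<in> H"
      then show "openin X (h x ` B) \<and> h x ` B \<noteq> {}"
        using h H(1,3) B(1) homeomorphic_imp_open_map[of X X "h x"]
        by (auto simp: local_pi_base_def open_map_def)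
    next
      fix T assume "T \<in> [H]\<^bsup>3\<^esup>"
      then show "(\<Inter>x\<in>T. h x ` B) = {}"
        using f[of T] H(4) nsets_mono[OF H(1)] by blast
    qed
    then show False
      using H(2) not_ordLess_ordLeq by blast
  qed
qed

end
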